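(* Let $P_n$ be the path graph with vertices $1,\dots,n$ and edges $\{i,i+1\}$, $1\le i\le n-1$. (1) For every integer $r$ with $0\le r\le\lfloor n/2\rfloor-1$ (so $n\ge 2r+2$), $$\nu\Big(\tfrac{1}{2r+1},P_n\Big)=\Big\lfloor\frac{n+2r}{2r+1}\Big\rfloor,$$ and there is an eigenvector $\vec\phi$ with eigenvalue $\frac1{2r+1}$ with $S(\vec\phi)=\nu(\frac1{2r+1},P_n)$; such a $\vec\phi$ can be chosen so that its nodal domains are the two end blocks $\{1,\dots,r+1\}$ and $\{n-r,\dots,n\}$ together with blocks of $2r+1$ consecutive vertices in between. (2) For every integer $r$ with $1\le r\le\lfloor (n-2)/4\rfloor$ (so $n\ge 4r+2$), $$\nu\Big(\tfrac{1}{2r},P_n\Big)=\Big\lfloor\frac{n-2}{2r}\Big\rfloor-1,$$ and there is an eigenvector $\vec\phi$ with eigenvalue $\frac1{2r}$ with $S(\vec\phi)=\nu(\frac1{2r},P_n)$; such a $\vec\phi$ can be chosen so that it vanishes on a block of vertices at each end of the path and its nodal domains are blocks of $2r$ consecutive vertices in between.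
   Context: For a finite simple connected graph $G=(V,E)$, $V=\{1,\dots,n\}$, $n\ge2$, with degrees $d_i$: $\mathrm{Sgn}(t)=\{1\}$ if $t>0$, $\{-1\}$ if $t<0$, $[-1,1]$ if $t=0$. A nonzero $\vec x\in\mathbb R^n$ is an eigenvector of the $1$-Laplacian with eigenvalue $\mu$ if there exist $z_{ij}\in\mathrm{Sgn}(x_i-x_j)$ with $z_{ji}=-z_{ij}$ (for all adjacent $i,j$) such that $\sum_{j\sim i}z_{ij}\in\mu d_i\,\mathrm{Sgn}(x_i)$ for all $i\in V$. The (strong) nodal domains of $\vec x$ are the vertex sets of the connected components of the subgraphs induced on $\{i:x_i>0\}$ and on $\{i:x_i<0\}$; $S(\vec x)$ is the total number of them. For an eigenvalue $\mu$ of $G$, $\nu(\mu,G)$ is the maximum of $S(\vec\phi)$ over all eigenvectors $\vec\phi$ of $G$ with eigenvalue $\mu$. *)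

theory Defs
  imports Complex_Main "Graph_Theory.Graph_Theory"
begin

definition Sgn :: "real \<Rightarrow> real set" where
  "Sgn t = (if t > 0 then {1} else if t < 0 then {-1} else {-1..1})"

text \<open>Simple graphs are loop-free symmetric digraphs (\<^locale>\<open>pair_graph\<close>), so the
  degree of a vertex is its out-degree. A vector indexed by the vertices is a function of which
  only the values on \<^term>\<open>pverts G\<close> matter.\<close>

definition laplacian1_eigenvector :: "'a pair_pre_digraph \<Rightarrow> real \<Rightarrow> ('a \<Rightarrow> real) \<Rightarrow> bool" where
  "laplacian1_eigenvector G \<mu> x \<longleftrightarrow>
     (\<exists>i\<in>pverts G. x i \<noteq> 0) \<and>
     (\<exists>z :: 'a \<Rightarrow> 'a \<Rightarrow> real.
        (\<forall>(i, j)\<in>parcs G. z i j \<in> Sgn (x i - x j) \<and> z j i = - z i j) \<and>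
        (\<forall>i\<in>pverts G. (\<Sum>j | (i, j) \<in> parcs G. z i j)
            \<in> (\<lambda>s. \<mu> * real (out_degree (with_proj G) i) * s) ` Sgn (x i)))"

text \<open>In a symmetric digraph the strongly connected components are the connected components.\<close>

definition component_verts :: "'a pair_pre_digraph \<Rightarrow> 'a set \<Rightarrow> 'a set set" where
  "component_verts G W = pre_digraph.sccs_verts (with_proj G \<restriction> W)"

definition nodal_domains :: "'a pair_pre_digraph \<Rightarrow> ('a \<Rightarrow> real) \<Rightarrow> 'a set set" where
  "nodal_domains G x =
     component_verts G {i\<in>pverts G. x i > 0} \<union> component_verts G {i\<in>pverts G. x i < 0}"

definition nodal_count :: "'a pair_pre_digraph \<Rightarrow> ('a \<Rightarrow> real) \<Rightarrow> nat" where
  "nodal_count G x = card (nodal_domains G x)"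

text \<open>Only meaningful if \<open>\<mu>\<close> is an eigenvalue of the finite graph \<open>G\<close>, as otherwise the
  maximum is taken over the empty set.\<close>

definition max_nodal_count :: "real \<Rightarrow> 'a pair_pre_digraph \<Rightarrow> nat" where
  "max_nodal_count \<mu> G = Max {nodal_count G \<phi> |\<phi>. laplacian1_eigenvector G \<mu> \<phi>}"

definition path_graph :: "nat \<Rightarrow> nat pair_pre_digraph" where
  "path_graph n = \<lparr> pverts = {1..n},
     parcs = {(i, j). i \<in> {1..n} \<and> j \<in> {1..n} \<and> (j = i + 1 \<or> i = j + 1)} \<rparr>"

lemma pair_graph_path_graph: "pair_graph (path_graph n)"
proof
  show "finite (parcs (path_graph n))"
    by (rule finite_subset[of _ "{1..n} \<times> {1..n}"]) (auto simp: path_graph_def)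
qed (auto simp: path_graph_def symmetric_def sym_def)

lemma strongly_connected_path_graph:
  assumes "n \<ge> 1"
  shows "strongly_connected (with_proj (path_graph n))"
proof -
  interpret pair_graph "path_graph n" by (rule pair_graph_path_graph)
  have *: "1 \<rightarrow>\<^sup>*\<^bsub>with_proj (path_graph n)\<^esub> k" if "1 \<le> k" "k \<le> n" for k
    using that
  proof (induction k rule: dec_induct)
    case base
    show ?case using assms by (intro reachable_refl) (simp add: path_graph_def)
  next
    case (step k)
    then have "k \<rightarrow>\<^bsub>with_proj (path_graph n)\<^esub> Suc k" by (auto simp: path_graph_def)
    with step show ?case by (auto intro: reachable_adj_trans)
  qed
  show ?thesis
  proof (rule strongly_connectedI)
    show "verts (with_proj (path_graph n)) \<noteq> {}" using assms by (simp add: path_graph_def)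
    fix u v
    assume "u \<in> verts (with_proj (path_graph n))" "v \<in> verts (with_proj (path_graph n))"
    then have "1 \<le> u" "u \<le> n" "1 \<le> v" "v \<le> n" by (simp_all add: path_graph_def)
    note u = *[OF this(1,2)] and v = *[OF this(3,4)]
    show "u \<rightarrow>\<^sup>*\<^bsub>with_proj (path_graph n)\<^esub> v"
      by (rule reachable_trans[OF symmetric_reachable[OF sym_arcs u] v])
  qed
qed

lemma component_verts_conv:
  assumes "pair_graph G"
  shows "component_verts G W = verts ` pre_digraph.sccs (with_proj G \<restriction> W)"
proof -
  interpret pair_graph G by fact
  interpret H: wf_digraph "with_proj G \<restriction> W" by (rule wellformed_induce_subgraph)
  show ?thesis unfolding component_verts_def by (rule H.sccs_verts_conv)
qed

lemma finite_nodal_counts: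
  assumes "pair_graph G"
  shows "finite {nodal_count G \<phi> |\<phi>. laplacian1_eigenvector G \<mu> \<phi>}"
proof -
  interpret pair_graph G by fact
  have sub: "component_verts G W \<subseteq> Pow W" for W
  proof -
    interpret H: wf_digraph "with_proj G \<restriction> W" by (rule wellformed_induce_subgraph)
    show ?thesis
      unfolding component_verts_conv[OF assms] H.sccs_def induced_subgraph_def subgraph_def
      by auto
  qed
  have "nodal_count G \<phi> \<le> card (Pow (pverts G))" for \<phi>
    unfolding nodal_count_def nodal_domains_def
  proof (rule card_mono)
    show "finite (Pow (pverts G))" by simp
    show "component_verts G {i\<in>pverts G. \<phi> i > 0} \<union> component_verts G {i\<in>pverts G. \<phi> i < 0}
        \<subseteq> Pow (pverts G)"
      using sub[of "{i\<in>pverts G. \<phi> i > 0}"] sub[of "{i\<in>pverts G. \<phi> i < 0}"] by blast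
  qed
  then have "{nodal_count G \<phi> |\<phi>. laplacian1_eigenvector G \<mu> \<phi>} \<subseteq> {..card (Pow (pverts G))}"
    by blast
  then show ?thesis by (rule finite_subset) simp
qed

end

theory Submission
  imports Defs
begin

text \<open>Write an eigenvector equation on the path as a flow \<open>f\<close> along the edges: \<open>f i = z i (i + 1)\<close>,
  so that \<open>f\<close> changes at vertex \<open>i\<close> by an element of \<open>\<mu> d\<^sub>i Sgn (x\<^sub>i)\<close>. Let \<open>\<mu> = 1/L\<close> and
  \<open>h = \<lfloor>L/2\<rfloor> + 1\<close>. On a nodal domain away from the ends the flow moves between \<open>-1\<close> and \<open>1\<close> in
  steps of \<open>2/L\<close>, so the domain has exactly \<open>L\<close> vertices; a domain containing an end of the path
  carries the flow from \<open>0\<close> to \<open>1\<close> and exists only for odd \<open>L\<close>, with \<open>h\<close> vertices. Since the flow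
  needs \<open>h\<close> vertices to reach \<open>1\<close> from \<open>0\<close>, every other domain lies in \<open>{h+1..n-h}\<close>, and the
  bounds follow by counting vertices. They are attained by alternating signs on consecutive
  blocks, with the flow a triangle wave.\<close>

section \<open>Nodal domains of the path\<close>

lemma dominates_induce_path_graph:
  assumes "W \<subseteq> {1..n}"
  shows "u \<rightarrow>\<^bsub>with_proj (path_graph n) \<restriction> W\<^esub> v \<longleftrightarrow> u \<in> W \<and> v \<in> W \<and> (v = Suc u \<or> u = Suc v)"
  using assms by (auto simp: arcs_ends_conv path_graph_def image_iff)

lemma reachable_induce_path_graph_up:
  assumes W: "W \<subseteq> {1..n}" and "u \<le> v" "{u..v} \<subseteq> W"
  shows "u \<rightarrow>\<^sup>*\<^bsub>with_proj (path_graph n) \<restriction> W\<^esub> v" "v \<rightarrow>\<^sup>*\<^bsub>with_proj (path_graph n) \<restriction> W\<^esub> u"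
proof -
  interpret pair_graph "path_graph n" by (rule pair_graph_path_graph)
  interpret H: wf_digraph "with_proj (path_graph n) \<restriction> W" by (rule wellformed_induce_subgraph)
  have "u \<rightarrow>\<^sup>*\<^bsub>with_proj (path_graph n) \<restriction> W\<^esub> v \<and> v \<rightarrow>\<^sup>*\<^bsub>with_proj (path_graph n) \<restriction> W\<^esub> u"
    using assms(2,3)
  proof (induction v rule: dec_induct)
    case base
    then show ?case using W by (auto intro!: H.reachable_refl)
  next
    case (step k)
    then have "k \<in> W" "Suc k \<in> W" by auto
    then have "k \<rightarrow>\<^bsub>with_proj (path_graph n) \<restriction> W\<^esub> Suc k" "Suc k \<rightarrow>\<^bsub>with_proj (path_graph n) \<restriction> W\<^esub> k"
      by (simp_all only: dominates_induce_path_graph[OF W] simp_thms)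
    moreover have "{u..k} \<subseteq> W" using step.prems by auto
    ultimately show ?case
      using step.IH by (blast intro: H.reachable_adj_trans H.adj_reachable_trans)
  qed
  then show "u \<rightarrow>\<^sup>*\<^bsub>with_proj (path_graph n) \<restriction> W\<^esub> v" "v \<rightarrow>\<^sup>*\<^bsub>with_proj (path_graph n) \<restriction> W\<^esub> u" by auto
qed

text \<open>A walk moves by one vertex at a time and so cannot jump over a vertex. If
  \<open>u > v\<close>, the interval is empty.\<close>

lemma reachable_induce_path_graph_between:
  assumes W: "W \<subseteq> {1..n}" and "u \<rightarrow>\<^sup>*\<^bsub>with_proj (path_graph n) \<restriction> W\<^esub> v"
  shows "{u..v} \<subseteq> W"
proof -
  interpret pair_graph "path_graph n" by (rule pair_graph_path_graph)
  interpret H: wf_digraph "with_proj (path_graph n) \<restriction> W" by (rule wellformed_induce_subgraph)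
  show ?thesis using assms(2)
  proof (induction rule: H.converse_reachable_induct)
    case base
    then show ?case by simp
  next
    case (step x y)
    then have "x \<in> W" "y = Suc x \<or> x = Suc y" by (simp_all only: dominates_induce_path_graph[OF W])
    moreover have "{x..v} \<subseteq> insert x {y..v}" if "y = Suc x \<or> x = Suc y" using that by auto
    ultimately show ?case using step.IH by blast
  qed
qed

lemma Union_component_verts:
  assumes "pair_graph G" "W \<subseteq> pverts G"
  shows "\<Union> (component_verts G W) = W"
proof -
  interpret pair_graph G by fact
  interpret H: wf_digraph "with_proj G \<restriction> W" by (rule wellformed_induce_subgraph)
  have "x \<in> \<Union> (component_verts G W)" if "x \<in> W" for x
  proof -
    have "x \<in> verts (with_proj G \<restriction> W)" using that assms(2) by auto
    then show ?thesis
      unfolding component_verts_def using H.scc_of_in_sccs_verts H.in_scc_of_self by blast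
  qed
  moreover have "\<Union> (component_verts G W) \<subseteq> W"
    unfolding component_verts_def using H.sccs_verts_subsets by fastforce
  ultimately show ?thesis by blast
qed

lemma component_verts_disjoint:
  assumes "pair_graph G" "S \<in> component_verts G W" "T \<in> component_verts G W" "S \<noteq> T"
  shows "S \<inter> T = {}"
proof -
  interpret pair_graph G by fact
  interpret H: wf_digraph "with_proj G \<restriction> W" by (rule wellformed_induce_subgraph)
  show ?thesis using assms(2-) unfolding component_verts_def by (rule H.sccs_verts_disjoint)
qed

text \<open>Walks fill the interval between the least and the greatest vertex of a component, and
  maximality excludes the two vertices next to it. For \<open>a = 1\<close> the truncated
  \<open>a - 1\<close> is \<open>0\<close>, which is never in \<open>W\<close>.\<close>

lemma component_verts_path_graphE:
  assumes W: "W \<subseteq> {1..n}" and D: "D \<in> component_verts (path_graph n) W"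
  obtains a b where "a \<le> b" "D = {a..b}" "{a..b} \<subseteq> W" "a - 1 \<notin> W" "Suc b \<notin> W"
proof -
  let ?H = "with_proj (path_graph n) \<restriction> W"
  interpret pair_graph "path_graph n" by (rule pair_graph_path_graph)
  interpret H: wf_digraph ?H by (rule wellformed_induce_subgraph)
  have DW: "D \<subseteq> W"
    using Union_component_verts[OF pair_graph_path_graph, of W n] W D by (auto simp: path_graph_def)
  have D': "D \<noteq> {}" "\<And>u v. u \<in> D \<Longrightarrow> v \<in> D \<Longrightarrow> u \<rightarrow>\<^sup>*\<^bsub>?H\<^esub> v"
    "\<And>u v. u \<in> D \<Longrightarrow> u \<rightarrow>\<^sup>*\<^bsub>?H\<^esub> v \<Longrightarrow> v \<rightarrow>\<^sup>*\<^bsub>?H\<^esub> u \<Longrightarrow> v \<in> D"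
    using D unfolding component_verts_def H.in_sccs_verts_conv_reachable by blast+
  define a where "a = Min D"
  define b where "b = Max D"
  have fin: "finite D" using DW W by (meson finite_atLeastAtMost finite_subset)
  then have ab: "a \<in> D" "b \<in> D" "\<And>u. u \<in> D \<Longrightarrow> a \<le> u \<and> u \<le> b"
    using D'(1) by (simp_all add: a_def b_def)
  have sub: "{a..b} \<subseteq> W" using reachable_induce_path_graph_between[OF W D'(2)] ab by blast
  have up: "v \<in> D" if "{a..v} \<subseteq> W" "a \<le> v" for v
    using D'(3)[OF ab(1)] reachable_induce_path_graph_up[OF W that(2,1)] by blast
  have "a \<le> b" using ab by blast
  moreover have "D = {a..b}"
  proof
    show "D \<subseteq> {a..b}" using ab(3) by auto
    show "{a..b} \<subseteq> D"
    proof
      fix v assume "v \<in> {a..b}"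
      moreover from this have "{a..v} \<subseteq> W" using sub by auto
      ultimately show "v \<in> D" using up by auto
    qed
  qed
  moreover have "a - 1 \<notin> W"
  proof
    assume *: "a - 1 \<in> W"
    then have "1 \<le> a - 1" using W by auto
    moreover have "{a - 1..a} \<subseteq> insert (a - 1) {a..b}" using ab(3)[OF ab(2)] \<open>a \<le> b\<close> by auto
    then have "{a - 1..a} \<subseteq> W" using * sub by blast
    then have "a - 1 \<in> D" using D'(3)[OF ab(1)] reachable_induce_path_graph_up[OF W, of "a - 1" a] by auto
    ultimately show False using ab(3)[of "a - 1"] by auto
  qed
  moreover have "Suc b \<notin> W"
  proof
    assume *: "Suc b \<in> W"
    have "{a..Suc b} \<subseteq> insert (Suc b) {a..b}" by auto
    then have "{a..Suc b} \<subseteq> W" using * sub by blast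
    then have "Suc b \<in> D" using up \<open>a \<le> b\<close> by simp
    then show False using ab(3)[of "Suc b"] by auto
  qed
  ultimately show ?thesis using that sub by blast
qed

lemma Union_nodal_domains:
  assumes "pair_graph G"
  shows "\<Union> (nodal_domains G x) = {i \<in> pverts G. x i \<noteq> 0}"
proof -
  have "\<Union> (nodal_domains G x) = {i \<in> pverts G. x i > 0} \<union> {i \<in> pverts G. x i < 0}"
    unfolding nodal_domains_def Union_Un_distrib by (simp add: Union_component_verts[OF assms])
  then show ?thesis by auto
qed

lemma pairwise_disjnt_nodal_domains:
  assumes "pair_graph G"
  shows "pairwise disjnt (nodal_domains G x)"
proof (rule pairwiseI)
  fix S T assume "S \<in> nodal_domains G x" "T \<in> nodal_domains G x" "S \<noteq> T"
  moreover have "\<Union> (component_verts G {i \<in> pverts G. x i > 0}) = {i \<in> pverts G. x i > 0}"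
    "\<Union> (component_verts G {i \<in> pverts G. x i < 0}) = {i \<in> pverts G. x i < 0}"
    by (simp_all add: Union_component_verts[OF assms])
  then have "S \<inter> T = {}" if "S \<in> component_verts G {i \<in> pverts G. x i > 0}"
    "T \<in> component_verts G {i \<in> pverts G. x i < 0}" for S T
    using that by (force dest: Union_upper)
  ultimately show "disjnt S T"
    unfolding nodal_domains_def disjnt_def using component_verts_disjoint[OF assms] by blast
qed

text \<open>The sign \<open>s\<close> merges positive and negative domains into one case, so that
  every domain can be treated as a positive one.\<close>

lemma nodal_domain_path_graphE:
  assumes "D \<in> nodal_domains (path_graph n) x"
  obtains a b and s :: real where "s = 1 \<or> s = - 1" "1 \<le> a" "a \<le> b" "b \<le> n" "D = {a..b}"
    "\<And>i. i \<in> {a..b} \<Longrightarrow> s * x i > 0"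
    "1 < a \<Longrightarrow> s * x (a - 1) \<le> 0" "b < n \<Longrightarrow> s * x (Suc b) \<le> 0"
proof -
  have "\<exists>s::real. (s = 1 \<or> s = - 1) \<and> D \<in> component_verts (path_graph n) {i\<in>{1..n}. s * x i > 0}"
  proof (cases "D \<in> component_verts (path_graph n) {i\<in>pverts (path_graph n). x i > 0}")
    case True
    then show ?thesis by (intro exI[of _ 1]) (simp add: path_graph_def)
  next
    case False
    then show ?thesis using assms unfolding nodal_domains_def
      by (intro exI[of _ "- 1"]) (simp add: path_graph_def)
  qed
  then obtain s :: real where s: "s = 1 \<or> s = - 1"
    and "D \<in> component_verts (path_graph n) {i\<in>{1..n}. s * x i > 0}" by blast
  from component_verts_path_graphE[OF _ this(2)] obtain a b where ab:
    "a \<le> b" "D = {a..b}" "{a..b} \<subseteq> {i\<in>{1..n}. s * x i > 0}"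
    "a - 1 \<notin> {i\<in>{1..n}. s * x i > 0}" "Suc b \<notin> {i\<in>{1..n}. s * x i > 0}" by blast
  have "a \<in> {a..b}" "b \<in> {a..b}" using ab(1) by auto
  then have "1 \<le> a" "b \<le> n" using ab(3) by auto
  show ?thesis
    by (rule that[OF s \<open>1 \<le> a\<close> ab(1) \<open>b \<le> n\<close> ab(2)]) (use ab \<open>b \<le> n\<close> in auto)
qed

section \<open>Eigenvectors as flows\<close>

lemma abs_le_1_Sgn: "\<bar>s\<bar> \<le> 1 \<Longrightarrow> s \<in> Sgn 0"
  by (auto simp: Sgn_def)

lemma abs_Sgn: "s \<in> Sgn t \<Longrightarrow> \<bar>s\<bar> \<le> 1"
  by (auto simp: Sgn_def split: if_splits)

lemma Sgn_uminus: "s \<in> Sgn t \<Longrightarrow> - s \<in> Sgn (- t)"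
  by (auto simp: Sgn_def split: if_splits)

definition path_deg :: "nat \<Rightarrow> nat \<Rightarrow> nat" where
  "path_deg n i = (if i = 1 \<or> i = n then 1 else 2)"

lemma neighbours_path_graph:
  assumes "i \<in> {1..n}"
  shows "{j. (i, j) \<in> parcs (path_graph n)} =
    (if i = 1 then {} else {i - 1}) \<union> (if i = n then {} else {Suc i})"
  using assms by (auto simp: path_graph_def)

lemma out_degree_path_graph:
  assumes "n \<ge> 2" "i \<in> {1..n}"
  shows "out_degree (with_proj (path_graph n)) i = path_deg n i"
proof -
  have "out_arcs (with_proj (path_graph n)) i = Pair i ` {j. (i, j) \<in> parcs (path_graph n)}"
    by (auto simp: out_arcs_def)
  then show ?thesis
    using assms by (auto simp: out_degree_def neighbours_path_graph path_deg_def)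
qed

text \<open>An antisymmetric \<open>z\<close> on the path amounts to one number per edge. Padding
  with \<open>f 0 = f n = 0\<close> makes the sum at each vertex, the ends included, the difference
  \<open>f i - f (i - 1)\<close>.\<close>

lemma laplacian1_eigenvector_path_graph_iff:
  assumes n: "n \<ge> 2"
  shows "laplacian1_eigenvector (path_graph n) \<mu> x \<longleftrightarrow>
    (\<exists>i\<in>{1..n}. x i \<noteq> 0) \<and>
    (\<exists>f. f 0 = 0 \<and> f n = 0 \<and> (\<forall>i\<in>{1..<n}. f i \<in> Sgn (x i - x (Suc i))) \<and>
      (\<forall>i\<in>{1..n}. \<exists>s\<in>Sgn (x i). f i - f (i - 1) = \<mu> * real (path_deg n i) * s))"
    (is "?L \<longleftrightarrow> ?x \<and> (\<exists>f. ?F f)")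
proof -
  have verts: "pverts (path_graph n) = {1..n}" by (simp add: path_graph_def)
  show ?thesis
  proof
    assume ?L
    then obtain z where x: ?x
      and z': "\<forall>(i, j)\<in>parcs (path_graph n). z i j \<in> Sgn (x i - x j) \<and> z j i = - z i j"
      and sum: "\<forall>i\<in>{1..n}. (\<Sum>j | (i, j) \<in> parcs (path_graph n). z i j)
        \<in> (\<lambda>s. \<mu> * real (out_degree (with_proj (path_graph n)) i) * s) ` Sgn (x i)"
      unfolding laplacian1_eigenvector_def verts by blast
    have z: "z i j \<in> Sgn (x i - x j) \<and> z j i = - z i j" if "(i, j) \<in> parcs (path_graph n)" for i j
      using z' that by auto
    define f where "f i = (if 1 \<le> i \<and> i < n then z i (Suc i) else 0)" for i
    have zf: "z i (Suc i) = f i" "z (Suc i) i = - f i" "f i \<in> Sgn (x i - x (Suc i))"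
      if "1 \<le> i" "i < n" for i
      using z[of i "Suc i"] that by (auto simp: f_def path_graph_def)
    have "\<exists>s\<in>Sgn (x i). f i - f (i - 1) = \<mu> * real (path_deg n i) * s" if i: "i \<in> {1..n}" for i
    proof -
      have "(\<Sum>j | (i, j) \<in> parcs (path_graph n). z i j) = f i - f (i - 1)"
        unfolding neighbours_path_graph[OF i]
        using i n zf(2)[of "i - 1"] zf(1)[of i] by (auto simp: f_def)
      then show ?thesis using bspec[OF sum i] by (auto simp: out_degree_path_graph[OF n i])
    qed
    then have "?F f" using zf by (auto simp: f_def)
    with x show "?x \<and> (\<exists>f. ?F f)" by blast
  next
    assume "?x \<and> (\<exists>f. ?F f)"
    then obtain f where x: ?x and f: "f 0 = 0" "f n = 0"
      "\<And>i. 1 \<le> i \<Longrightarrow> i < n \<Longrightarrow> f i \<in> Sgn (x i - x (Suc i))"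
      "\<And>i. i \<in> {1..n} \<Longrightarrow> \<exists>s\<in>Sgn (x i). f i - f (i - 1) = \<mu> * real (path_deg n i) * s" by auto
    define z where "z i j = (if j = Suc i then f i else - f j)" for i j
    have "z i j \<in> Sgn (x i - x j) \<and> z j i = - z i j" if ij: "(i, j) \<in> parcs (path_graph n)" for i j
    proof -
      consider "1 \<le> i" "i < n" "j = Suc i" | "1 \<le> j" "j < n" "i = Suc j"
        using ij by (auto simp: path_graph_def)
      then show ?thesis
      proof cases
        case 1
        then show ?thesis using f(3) by (simp add: z_def)
      next
        case 2
        then show ?thesis using Sgn_uminus[OF f(3)[of j]] by (simp add: z_def)
      qed
    qed
    moreover have "(\<Sum>j | (i, j) \<in> parcs (path_graph n). z i j)
        \<in> (\<lambda>s. \<mu> * real (out_degree (with_proj (path_graph n)) i) * s) ` Sgn (x i)"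
      if i: "i \<in> {1..n}" for i
    proof -
      have "(\<Sum>j | (i, j) \<in> parcs (path_graph n). z i j) = f i - f (i - 1)"
        unfolding neighbours_path_graph[OF i] using i n f(1,2) by (auto simp: z_def)
      then show ?thesis using f(4)[OF i] by (auto simp: out_degree_path_graph[OF n i])
    qed
    ultimately show ?L
      using x unfolding laplacian1_eigenvector_def verts by (intro conjI exI[of _ z]) auto
  qed
qed

section \<open>Shape of the nodal domains\<close>

text \<open>For \<mu> > 0 and up to the factor \<mu>, this bounds how far the flow can travel over
  the first \<open>i\<close> vertices; it is the exact distance where the vector is positive
  throughout.\<close>

definition path_vol :: "nat \<Rightarrow> nat \<Rightarrow> nat" where
  "path_vol n i = (\<Sum>k\<in>{1..i}. path_deg n k)"

lemma path_vol_0: "path_vol n 0 = 0"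
  by (simp add: path_vol_def)

lemma path_vol_Suc: "path_vol n (Suc i) = path_vol n i + path_deg n (Suc i)"
  by (simp add: path_vol_def)

lemma path_vol_less: "1 \<le> i \<Longrightarrow> i < n \<Longrightarrow> path_vol n i = 2 * i - 1"
  by (induction i rule: dec_induct) (simp_all add: path_vol_Suc path_vol_def path_deg_def)

lemma path_vol_total: "2 \<le> n \<Longrightarrow> path_vol n n = 2 * n - 2"
  using path_vol_Suc[of n "n - 1"] path_vol_less[of "n - 1" n] by (simp add: path_deg_def)

text \<open>The least number of vertices at an end of the path within which the flow can grow from \<open>0\<close> to
  \<open>1\<close> at eigenvalue \<open>1/L\<close>.\<close>

definition end_width :: "nat \<Rightarrow> nat" where
  "end_width L = L div 2 + 1"

text \<open>Across a domain the flow moves by exactly \<mu> times the volume. Its values on the two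
  sides are known: \<open>0\<close> at an end of the path, of modulus \<open>1\<close> elsewhere.
  Comparing the two gives the size of the domain; the volume outside it bounds its distance from the
  ends.\<close>

lemma nodal_domain_cases:
  assumes n: "n \<ge> 2" and L: "L \<ge> 1"
    and ev: "laplacian1_eigenvector (path_graph n) (1 / real L) x"
    and D: "D \<in> nodal_domains (path_graph n) x"
  shows "odd L \<and> D = {1..end_width L} \<or> odd L \<and> D = {n - end_width L + 1..n} \<or>
    (\<exists>k. end_width L < k \<and> k + L \<le> n - end_width L + 1 \<and> D = {k..<k + L})"
proof -
  from ev obtain f where f: "f 0 = 0" "f n = 0"
    "\<And>i. 1 \<le> i \<Longrightarrow> i < n \<Longrightarrow> f i \<in> Sgn (x i - x (Suc i))"
    "\<And>i. i \<in> {1..n} \<Longrightarrow> \<exists>s\<in>Sgn (x i). f i - f (i - 1) = 1 / real L * real (path_deg n i) * s"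
    unfolding laplacian1_eigenvector_path_graph_iff[OF n] by auto
  obtain a b s where s: "s = 1 \<or> s = - 1" and ab: "1 \<le> a" "a \<le> b" "b \<le> n" "D = {a..b}"
    and pos: "\<And>i. i \<in> {a..b} \<Longrightarrow> s * x i > 0"
    and bd: "1 < a \<Longrightarrow> s * x (a - 1) \<le> 0" "b < n \<Longrightarrow> s * x (Suc b) \<le> 0"
    by (rule nodal_domain_path_graphE[OF D]) (use that in blast)
  \<comment> \<open>The factor \<open>s\<close> makes the domain positive, and \<open>L\<close>
    cancels the eigenvalue, so that each change of \<open>g\<close> is a degree times an element of
    \<open>Sgn\<close>.\<close>
  define g where "g i = s * real L * f i" for i
  have g0: "g 0 = 0" "g n = 0" using f by (simp_all add: g_def)
  have jump: "\<exists>t\<in>Sgn (s * x (Suc i)). g (Suc i) = g i + real (path_deg n (Suc i)) * t"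
    if i: "Suc i \<le> n" for i
  proof -
    obtain t where t: "t \<in> Sgn (x (Suc i))"
      and "f (Suc i) - f (Suc i - 1) = 1 / real L * real (path_deg n (Suc i)) * t"
      using f(4)[of "Suc i"] i by auto
    then have "g (Suc i) - g i = real (path_deg n (Suc i)) * (s * t)"
      using L by (simp add: g_def field_simps flip: right_diff_distrib)
    moreover have "s * t \<in> Sgn (s * x (Suc i))" using s t Sgn_uminus by auto
    ultimately show ?thesis by (intro bexI[of _ "s * t"]) auto
  qed
  have lip: "\<bar>g (Suc i) - g i\<bar> \<le> real (path_deg n (Suc i))" if i: "Suc i \<le> n" for i
  proof -
    obtain t where t: "t \<in> Sgn (s * x (Suc i))" "g (Suc i) = g i + real (path_deg n (Suc i)) * t"
      using jump[OF i] by blast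
    then show ?thesis using abs_Sgn[OF t(1)] by (simp add: abs_mult mult_left_le)
  qed
  \<comment> \<open>Since \<open>g\<close> vanishes at both ends of the path, the volume on either
    side limits its size.\<close>
  have left: "\<bar>g i\<bar> \<le> real (path_vol n i)" if "i \<le> n" for i
    using that
  proof (induction i)
    case (Suc i)
    then show ?case using lip[of i] by (simp add: path_vol_Suc)
  qed (simp add: g0)
  have right: "\<bar>g i\<bar> \<le> real (path_vol n n) - real (path_vol n i)" if "i \<le> n" for i
    using that
  proof (induction i rule: inc_induct)
    case (step i)
    then show ?case using lip[of i] by (simp add: path_vol_Suc)
  qed (simp add: g0)
  \<comment> \<open>On the domain \<open>Sgn\<close> is the singleton \<open>{1}\<close>, so the
    Lipschitz bound becomes an equality.\<close>
  have "g i - g (a - 1) = real (path_vol n i) - real (path_vol n (a - 1))"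
    if "a - 1 \<le> i" "i \<le> b" for i
    using that
  proof (induction i rule: dec_induct)
    case (step i)
    then have i: "Suc i \<in> {a..b}" using ab by auto
    then show ?case
      using jump[of i] pos[OF i] step ab
      by (auto simp: Sgn_def path_vol_Suc)
  qed simp
  from this[of b] have inc: "g b - g (a - 1) = real (path_vol n b) - real (path_vol n (a - 1))"
    using ab by simp
  have Sg: "g i \<in> (*) (real L) ` Sgn (s * x i - s * x (Suc i))" if "1 \<le> i" "i < n" for i
    using f(3)[OF that] s Sgn_uminus[OF f(3)[OF that]]
    by (auto simp: g_def image_iff intro!: bexI[of _ "s * f i"])
  \<comment> \<open>On an edge leaving the domain \<open>s * x\<close> drops strictly, so the flow
    there is forced to be extreme.\<close>
  have gb: "g b = real L" if "b < n"
    using Sg[of b] bd(2)[OF that] pos[of b] ab that by (auto simp: Sgn_def)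
  have ga: "g (a - 1) = - real L" if "1 < a"
    using Sg[of "a - 1"] bd(1)[OF that] pos[of a] ab that by (auto simp: Sgn_def)
  have h: "odd L \<Longrightarrow> L + 1 = 2 * end_width L" "even L \<Longrightarrow> L + 2 = 2 * end_width L"
    by (auto simp: end_width_def)
  consider "a = 1" "b = n" | "a = 1" "b < n" | "1 < a" "b = n" | "1 < a" "b < n"
    using ab by linarith
  then show ?thesis
  proof cases
    case 1
    \<comment> \<open>A domain cannot fill the path: \<open>g\<close> is \<open>0\<close> at both
      ends but would have to rise by \<open>2 * n - 2\<close>.\<close>
    then show ?thesis using inc g0 n path_vol_total[OF n] by (simp add: path_vol_0)
  next
    case 2
    then have "real L = real (path_vol n b)" using inc gb g0 by (simp add: path_vol_0)
    then have "L = 2 * b - 1" using path_vol_less[of b n] 2 ab by simp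
    then have "odd L" "b = end_width L" using ab h by presburger+
    then show ?thesis using 2 ab by simp
  next
    case 3
    then have "real L = real (path_vol n n) - real (path_vol n (a - 1))" using inc ga g0 by simp
    then have "L = 2 * (n - a) + 1" using path_vol_less[of "a - 1" n] path_vol_total[OF n] 3 ab by auto
    then have "odd L" "n - a + 1 = end_width L" using h by auto
    moreover from this 3 ab have "a = n - end_width L + 1" by simp
    ultimately show ?thesis using 3 ab by simp
  next
    case 4
    have v: "path_vol n b = 2 * b - 1" "path_vol n (a - 1) = 2 * (a - 1) - 1"
      using path_vol_less 4 ab by auto
    have "2 * real L = real (path_vol n b) - real (path_vol n (a - 1))" using inc ga gb 4 by simp
    then have "Suc b = a + L" using v 4 ab by auto
    \<comment> \<open>Reaching \<open>-L\<close> at \<open>a - 1\<close> requires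
      \<open>L \<le> 2 * a - 3\<close>, which for either parity of \<open>L\<close> rounds to
      \<open>end_width L < a\<close>. The right side is symmetric.\<close>
    moreover have "L \<le> path_vol n (a - 1)" using left[of "a - 1"] ga 4 ab by auto
    then have "end_width L < a" using v 4 h by (cases "odd L") auto
    moreover have "real L \<le> real (path_vol n n) - real (path_vol n b)" using right[of b] gb 4 ab by auto
    then have "L \<le> 2 * n - 2 * b - 1" using v 4 ab path_vol_total[OF n] by auto
    then have "b \<le> n - end_width L" using 4 h by (cases "odd L") auto
    ultimately show ?thesis using ab by (intro disjI2 exI[of _ a]) auto
  qed
qed

section \<open>Counting the domains: the upper bound\<close>

text \<open>Domains other than the two end blocks are disjoint, have \<open>L\<close> vertices each
  and together cover the nonzero entries between the end blocks. The identity serves both the upper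
  bound and the exact count for the extremal vector.\<close>

lemma card_middle_nodal_domains:
  assumes n: "n \<ge> 2" and L: "L \<ge> 1" and h: "2 * end_width L \<le> n"
    and ev: "laplacian1_eigenvector (path_graph n) (1 / real L) x"
  defines "M \<equiv> nodal_domains (path_graph n) x - {{1..end_width L}, {n - end_width L + 1..n}}"
  shows "card M * L = card {i \<in> {end_width L<..n - end_width L}. x i \<noteq> 0}"
proof -
  let ?h = "end_width L"
  have verts: "pverts (path_graph n) = {1..n}" by (simp add: path_graph_def)
  have U: "\<Union> (nodal_domains (path_graph n) x) = {i \<in> {1..n}. x i \<noteq> 0}"
    using Union_nodal_domains[OF pair_graph_path_graph, of n x] unfolding verts .
  have M: "\<exists>k. ?h < k \<and> k + L \<le> n - ?h + 1 \<and> D = {k..<k + L}" if "D \<in> M" for D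
    using nodal_domain_cases[OF n L ev, of D] that by (auto simp: M_def)
  have "\<Union> M = {i \<in> {?h<..n - ?h}. x i \<noteq> 0}"
  proof
    show "\<Union> M \<subseteq> {i \<in> {?h<..n - ?h}. x i \<noteq> 0}"
    proof
      fix i assume "i \<in> \<Union> M"
      then obtain D where D: "i \<in> D" "D \<in> M" by blast
      then have "x i \<noteq> 0" using U by (auto simp: M_def)
      with D M[OF D(2)] show "i \<in> {i \<in> {?h<..n - ?h}. x i \<noteq> 0}" by auto
    qed
    show "{i \<in> {?h<..n - ?h}. x i \<noteq> 0} \<subseteq> \<Union> M"
    proof
      fix i assume i: "i \<in> {i \<in> {?h<..n - ?h}. x i \<noteq> 0}"
      then have "i \<in> \<Union> (nodal_domains (path_graph n) x)" unfolding U by auto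
      then obtain D where D: "i \<in> D" "D \<in> nodal_domains (path_graph n) x" by blast
      moreover have "D \<noteq> {1..?h}" "D \<noteq> {n - ?h + 1..n}" using D(1) i by auto
      ultimately show "i \<in> \<Union> M" by (auto simp: M_def)
    qed
  qed
  moreover have "pairwise disjnt M"
    unfolding M_def
    using pairwise_disjnt_nodal_domains[OF pair_graph_path_graph] Diff_subset by (rule pairwise_subset)
  moreover have "card D = L" "finite D" if "D \<in> M" for D using M[OF that] by auto
  ultimately show ?thesis
    using card_Union_disjoint[of M] by simp
qed

lemma nodal_count_path_graph_le:
  assumes "n \<ge> 2" "L \<ge> 1" "2 * end_width L \<le> n"
    and ev: "laplacian1_eigenvector (path_graph n) (1 / real L) x"
  shows "nodal_count (path_graph n) x
    \<le> (n - 2 * end_width L) div L + (if odd L then 2 else 0)"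
proof -
  let ?N = "nodal_domains (path_graph n) x"
  let ?E = "{{1..end_width L}, {n - end_width L + 1..n}}"
  have "card (?N - ?E) * L \<le> card {end_width L<..n - end_width L}"
    unfolding card_middle_nodal_domains[OF assms] by (intro card_mono) auto
  then have "card (?N - ?E) * L \<le> n - 2 * end_width L" by simp
  then have mid: "card (?N - ?E) \<le> (n - 2 * end_width L) div L"
    using \<open>L \<ge> 1\<close> by (simp add: less_eq_div_iff_mult_less_eq)
  have "card ?N \<le> card (?N - ?E) + card (?N \<inter> ?E)"
    using card_Un_le[of "?N - ?E" "?N \<inter> ?E"] by (simp add: Un_Diff_Int)
  moreover have "card (?N \<inter> ?E) \<le> (if odd L then 2 else 0)"
  proof (cases "odd L")
    case True
    have "card (?N \<inter> ?E) \<le> card ?E" by (intro card_mono) auto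
    also have "\<dots> \<le> 2" by (simp add: card_insert_if)
    finally show ?thesis using True by simp
  next
    case False
    \<comment> \<open>For even \<open>L\<close> every domain starts strictly between the two end
      blocks, so neither of these occurs.\<close>
    have "D \<notin> ?E" if D: "D \<in> ?N" for D
    proof -
      obtain k where k: "end_width L < k" "k + L \<le> n - end_width L + 1" "D = {k..<k + L}"
        using nodal_domain_cases[OF assms(1,2) ev D] False by blast
      then have "k \<in> D" "k \<notin> {1..end_width L}" "k \<notin> {n - end_width L + 1..n}"
        using \<open>L \<ge> 1\<close> by auto
      then show ?thesis by auto
    qed
    then have "?N \<inter> ?E = {}" by blast
    then show ?thesis by simp
  qed
  ultimately show ?thesis using mid unfolding nodal_count_def by linarith
qed

section \<open>The extremal eigenvector\<close>

text \<open>The offset \<open>+ 2\<close> makes the wave reach its peak \<open>1\<close> or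
  \<open>-1\<close> at the last index of each block of length \<open>L\<close>, so that the next
  block starts one step of size \<open>2/L\<close> away from it.\<close>

definition triangle_wave :: "nat \<Rightarrow> nat \<Rightarrow> real" where
  "triangle_wave L t = (- 1) ^ (t div L) * (2 * real (t mod L) + 2 - real L) / real L"

lemma abs_triangle_wave_le:
  assumes "L \<ge> 1"
  shows "\<bar>triangle_wave L t\<bar> \<le> 1"
proof -
  have "t mod L + 1 \<le> L" using assms by (simp add: Suc_leI)
  then have "real (t mod L) + 1 \<le> real L" by linarith
  then have "\<bar>2 * real (t mod L) + 2 - real L\<bar> \<le> real L" by linarith
  then show ?thesis using assms by (simp add: triangle_wave_def abs_mult power_abs divide_le_eq_1)
qed

text \<open>Between blocks the sign flips while the remainder resets, and the two effects combine to
  a step of the usual size in the direction of the new block; hence \<open>Suc t div L\<close> on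
  the right.\<close>

lemma triangle_wave_Suc:
  assumes "L \<ge> 1"
  shows "triangle_wave L (Suc t) - triangle_wave L t = (- 1) ^ (Suc t div L) * 2 / real L"
proof (cases "Suc (t mod L) = L")
  case True
  then have "Suc t mod L = 0" "Suc t div L = Suc (t div L)"
    by (simp_all add: mod_Suc div_Suc)
  moreover have m: "real (t mod L) = real L - 1" using True by linarith
  ultimately show ?thesis using assms unfolding triangle_wave_def m by (simp add: field_simps)
next
  case False
  then have "Suc t mod L = Suc (t mod L)" "Suc t div L = t div L"
    by (simp_all add: mod_Suc div_Suc)
  then show ?thesis using assms by (simp add: triangle_wave_def field_simps)
qed

lemma triangle_wave_peak:
  assumes "Suc (t mod L) = L"
  shows "triangle_wave L t = (- 1) ^ (t div L)"
proof -
  have m: "real (t mod L) = real L - 1" using assms by linarith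
  have "L > 0" using assms by linarith
  then show ?thesis unfolding triangle_wave_def m by (simp add: field_simps)
qed

text \<open>Contracts a gap of zeros of the extremal vector, placed after \<open>K\<close> inner blocks, and shifts
  indices so that the blocks are the classes of indices with equal quotient by \<open>L\<close>.\<close>

definition wave_index :: "nat \<Rightarrow> nat \<Rightarrow> nat \<Rightarrow> nat \<Rightarrow> nat" where
  "wave_index n L K i =
     (if i \<le> end_width L + L * K then i
      else if i \<le> n - end_width L then end_width L + L * K
      else i + 2 * end_width L + L * K - n) + L - 1 - end_width L"

text \<open>Each nonzero entry is the direction in which the wave moves on its block. All zeros
  outside the end blocks are gathered in one gap on the right.\<close>

definition extremal_vector :: "nat \<Rightarrow> nat \<Rightarrow> nat \<Rightarrow> nat \<Rightarrow> real" where
  "extremal_vector n L K i =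
     (if odd L \<and> (i \<le> end_width L \<or> n - end_width L < i) \<or>
         end_width L < i \<and> i \<le> end_width L + L * K
      then (- 1) ^ (wave_index n L K i div L) else 0)"

lemma minus_one_power_Sgn:
  "y = 0 \<or> y = (- 1) ^ k \<Longrightarrow> (- 1) ^ k \<in> Sgn y"
  by (cases "even k") (auto simp: Sgn_def)

text \<open>The flow is the wave, constant along the gap. Where the vector changes, the wave is at a
  peak; where it does not, a modulus of at most \<open>1\<close> suffices. Zero entries tolerate any
  step of the permitted size, which lets the flow build up over the vanishing ends for even
  \<open>L\<close>.\<close>

lemma extremal_vector_eigenvector:
  assumes n: "n \<ge> 2" and L: "L \<ge> 1" and K: "2 * end_width L + L * K \<le> n" and nz: "odd L \<or> K \<ge> 1"
  shows "laplacian1_eigenvector (path_graph n) (1 / real L) (extremal_vector n L K)"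
proof -
  define h where "h = end_width L"
  define x where "x = extremal_vector n L K"
  define p where "p = wave_index n L K"
  define f where "f i = (if i = 0 \<or> i = n then 0 else triangle_wave L (p i))" for i
  have hL: "odd L \<Longrightarrow> L + 1 = 2 * h" "even L \<Longrightarrow> L + 2 = 2 * h" "1 \<le> h" "h \<le> L"
    using L by (auto simp: h_def end_width_def)
  have LK: "K \<ge> 1 \<Longrightarrow> L \<le> L * K" by simp
  have x_if: "x i = (if odd L \<and> (i \<le> h \<or> n - h < i) \<or> h < i \<and> i \<le> h + L * K
      then (- 1) ^ (p i div L) else 0)" for i
    by (simp add: x_def extremal_vector_def p_def h_def)
  have p_if: "p i = (if i \<le> h + L * K then i else if i \<le> n - h then h + L * K
      else i + 2 * h + L * K - n) + L - 1 - h" for i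
    by (simp add: p_def wave_index_def h_def)
  have K': "2 * h + L * K \<le> n" using K by (simp add: h_def)
  have p_Suc: "p (Suc i) = (if h + L * K \<le> i \<and> i < n - h then p i else Suc (p i))" if "1 \<le> i" for i
    using that hL K' by (auto simp: p_if)
  have p_1: "p 1 = L - h" using hL by (simp add: p_if)
  have p_n: "p n = (K + 1) * L + (h - 1)" using hL K' by (simp add: p_if algebra_simps)
  \<comment> \<open>These are the last vertices of the left end block, of the last inner block and
    of the gap; some of them coincide if \<open>K = 0\<close> or the gap is empty.\<close>
  have peak: "Suc (p i mod L) = L" if "i = h \<or> i = h + L * K \<or> i = n - h" for i
  proof -
    have "p i = L - 1 \<or> p i = L - 1 + L * K" using that hL K' by (auto simp: p_if)
    then show ?thesis using L by (elim disjE) (simp_all only: mod_mult_self2, simp_all)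
  qed
  have "f i \<in> Sgn (x i - x (Suc i))" if i: "1 \<le> i" "i < n" for i
  proof -
    have fi: "f i = triangle_wave L (p i)" using i by (simp add: f_def)
    \<comment> \<open>Either neighbouring entries agree, or the wave peaks and any drop or rise of
      the vector has the sign of the peak.\<close>
    have "x i = x (Suc i) \<or> f i = (- 1) ^ (p i div L) \<and> (x i = 0 \<or> x i = f i) \<and> (x (Suc i) = 0 \<or> x (Suc i) = - f i)"
    proof (cases "Suc (p i mod L) = L")
      case True
      then have fp: "f i = (- 1) ^ (p i div L)" using fi triangle_wave_peak by simp
      show ?thesis
      proof (cases "h + L * K \<le> i \<and> i < n - h")
        case True
        then have "x (Suc i) = 0" using hL K' by (auto simp: x_if)
        then show ?thesis using fp by (simp add: x_if)
      next
        case False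
        then have "p (Suc i) div L = Suc (p i div L)"
          using p_Suc[OF i(1)] \<open>Suc (p i mod L) = L\<close> by (simp add: div_Suc mod_Suc)
        then show ?thesis using fp by (simp add: x_if)
      qed
    next
      case False
      then have "i \<noteq> h" "i \<noteq> h + L * K" "i \<noteq> n - h"
        using peak by metis+
      moreover have "p (Suc i) div L = p i div L" if "\<not> (h + L * K \<le> i \<and> i < n - h)"
        using p_Suc[OF i(1)] False that by (simp add: div_Suc mod_Suc)
      ultimately show ?thesis using hL K' by (auto simp: x_if)
    qed
    then show ?thesis
    proof
      assume "x i = x (Suc i)"
      then show ?thesis using abs_le_1_Sgn abs_triangle_wave_le[OF L] fi by simp
    next
      assume *: "f i = (- 1) ^ (p i div L) \<and> (x i = 0 \<or> x i = f i) \<and> (x (Suc i) = 0 \<or> x (Suc i) = - f i)"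
      then have "f i = 1 \<or> f i = - 1" by (cases "even (p i div L)") auto
      then show ?thesis using * by (auto simp: Sgn_def)
    qed
  qed
  moreover have "\<exists>s\<in>Sgn (x i). f i - f (i - 1) = 1 / real L * real (path_deg n i) * s"
    if i: "i \<in> {1..n}" for i
  proof -
    consider "i = 1" | "i = n" | "1 < i" "i < n" using i by fastforce
    then show ?thesis
    proof cases
      case 1
      have "L - h < L" using L hL by simp
      then have "triangle_wave L (p 1) = (2 * real (L - h) + 2 - real L) / real L"
        unfolding p_1 by (simp add: triangle_wave_def)
      then have "f 1 = (2 * real (L - h) + 2 - real L) / real L"
        using n by (simp add: f_def)
      \<comment> \<open>By the choice of \<open>h\<close> the first step is \<open>1/L\<close> for
        odd \<open>L\<close>, matching degree \<open>1\<close>, and \<open>0\<close> for even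
        \<open>L\<close>.\<close>
      also have "2 * real (L - h) + 2 - real L = (if odd L then 1 else 0)"
        using hL by (auto simp: of_nat_diff)
      finally show ?thesis
        using 1 n hL L p_1 by (intro bexI[of _ "if odd L then 1 else 0"])
          (auto simp: f_def path_deg_def x_if Sgn_def)
    next
      case 2
      have pn: "p n div L = K + 1" "p n mod L = h - 1"
      proof -
        have "h - 1 < L" using hL by simp
        then show "p n div L = K + 1" "p n mod L = h - 1"
          unfolding p_n by (subst div_mult_self3, simp_all only: mod_mult_self3 mod_less div_less)
      qed
      \<comment> \<open>As \<open>f n = 0\<close>, the change at \<open>n\<close> is minus the
        preceding wave value, found by stepping back from the value the wave would take at
        \<open>n\<close>.\<close>
      have "triangle_wave L (p n) - triangle_wave L (p (n - 1)) = (- 1) ^ (K + 1) * 2 / real L"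
        using p_Suc[of "n - 1"] n hL pn(1) triangle_wave_Suc[OF L, of "p (n - 1)"] by auto
      moreover have "triangle_wave L (p n) = (- 1) ^ (K + 1) * (2 * real h - real L) / real L"
        unfolding triangle_wave_def pn using hL by (simp add: of_nat_diff)
      ultimately have "- triangle_wave L (p (n - 1))
          = (- 1) ^ (K + 1) * 2 / real L - (- 1) ^ (K + 1) * (2 * real h - real L) / real L"
        by linarith
      also have "\<dots> = (- 1) ^ (K + 1) * (real L + 2 - 2 * real h) / real L"
        by (simp add: algebra_simps flip: diff_divide_distrib add_divide_distrib)
      also have "real L + 2 - 2 * real h = (if odd L then 1 else 0)"
        using hL by auto
      finally show ?thesis
        using 2 n hL L pn K' minus_one_power_Sgn[of _ "K + 1"]
        by (intro bexI[of _ "if odd L then (- 1) ^ (K + 1) else 0"])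
          (auto simp: f_def path_deg_def x_if abs_le_1_Sgn)
    next
      case 3
      then have f: "f i = triangle_wave L (p i)" "f (i - 1) = triangle_wave L (p (i - 1))"
        "path_deg n i = 2" by (auto simp: f_def path_deg_def)
      show ?thesis
      proof (cases "h + L * K \<le> i - 1 \<and> i - 1 < n - h")
        case True
        then have "p i = p (i - 1)" "x i = 0" using p_Suc[of "i - 1"] 3 hL by (auto simp: x_if)
        then show ?thesis using f by (intro bexI[of _ 0]) (auto simp: Sgn_def)
      next
        case False
        then have "p i = Suc (p (i - 1))" using p_Suc[of "i - 1"] 3 by auto
        then have "f i - f (i - 1) = (- 1) ^ (p i div L) * 2 / real L"
          using f triangle_wave_Suc[OF L, of "p (i - 1)"] by simp
        then show ?thesis using f
          by (intro bexI[of _ "(- 1) ^ (p i div L)"] minus_one_power_Sgn) (auto simp: x_if)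
      qed
    qed
  qed
  moreover have "\<exists>i\<in>{1..n}. x i \<noteq> 0"
  proof (cases "odd L")
    case True
    then show ?thesis using n hL by (intro bexI[of _ 1]) (auto simp: x_if)
  next
    case False
    then show ?thesis using nz LK L K' hL by (intro bexI[of _ "h + 1"]) (auto simp: x_if)
  qed
  moreover have "f 0 = 0" "f n = 0" by (simp_all add: f_def)
  ultimately show ?thesis
    unfolding laplacian1_eigenvector_path_graph_iff[OF n] x_def[symmetric]
    by (intro conjI exI[of _ f] ballI) simp_all
qed

section \<open>Domains of the extremal vector and the exact maximum\<close>

text \<open>Connectivity need not be examined again: the vector is an eigenvector, so its
  \<open>L * K\<close> nonzero middle entries form \<open>K\<close> domains, and the domains of the
  vertices \<open>1\<close> and \<open>n\<close> can only be the end blocks.\<close>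

lemma nodal_domains_extremal_vector:
  assumes n: "n \<ge> 2" and L: "L \<ge> 1" and K: "2 * end_width L + L * K \<le> n" and nz: "odd L \<or> K \<ge> 1"
  shows "card (nodal_domains (path_graph n) (extremal_vector n L K)
      - {{1..end_width L}, {n - end_width L + 1..n}}) = K"
    and "odd L \<Longrightarrow> {{1..end_width L}, {n - end_width L + 1..n}}
      \<subseteq> nodal_domains (path_graph n) (extremal_vector n L K)"
proof -
  let ?h = "end_width L"
  let ?x = "extremal_vector n L K"
  have h: "1 \<le> ?h" "2 * ?h \<le> n" using K by (auto simp: end_width_def)
  note ev = extremal_vector_eigenvector[OF assms]
  have "{i \<in> {?h<..n - ?h}. ?x i \<noteq> 0} = {?h<..?h + L * K}"
    using K by (auto simp: extremal_vector_def)
  then show "card (nodal_domains (path_graph n) ?x - {{1..?h}, {n - ?h + 1..n}}) = K"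
    using card_middle_nodal_domains[OF n L h(2) ev] L by simp
  have U: "\<Union> (nodal_domains (path_graph n) ?x) = {i \<in> {1..n}. ?x i \<noteq> 0}"
    using Union_nodal_domains[OF pair_graph_path_graph, of n ?x] by (simp add: path_graph_def)
  assume odd: "odd L"
  have "{1..?h} \<in> nodal_domains (path_graph n) ?x"
  proof -
    have "1 \<in> \<Union> (nodal_domains (path_graph n) ?x)"
      unfolding U using n h odd by (simp add: extremal_vector_def)
    then obtain D where D: "1 \<in> D" "D \<in> nodal_domains (path_graph n) ?x" by blast
    then have "D = {1..?h}" using nodal_domain_cases[OF n L ev D(2)] h by auto
    with D show ?thesis by simp
  qed
  moreover have "{n - ?h + 1..n} \<in> nodal_domains (path_graph n) ?x"
  proof -
    have "n \<in> \<Union> (nodal_domains (path_graph n) ?x)"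
      unfolding U using n h odd by (simp add: extremal_vector_def)
    then obtain D where D: "n \<in> D" "D \<in> nodal_domains (path_graph n) ?x" by blast
    then have "D = {n - ?h + 1..n}" using nodal_domain_cases[OF n L ev D(2)] h by auto
    with D show ?thesis by simp
  qed
  ultimately show "{{1..?h}, {n - ?h + 1..n}} \<subseteq> nodal_domains (path_graph n) ?x" by simp
qed

lemma nodal_count_extremal_vector:
  assumes n: "n \<ge> 2" and L: "L \<ge> 1" and K: "2 * end_width L + L * K \<le> n" and nz: "odd L \<or> K \<ge> 1"
  shows "nodal_count (path_graph n) (extremal_vector n L K) \<ge> K + (if odd L then 2 else 0)"
proof -
  let ?N = "nodal_domains (path_graph n) (extremal_vector n L K)"
  let ?E = "{{1..end_width L}, {n - end_width L + 1..n}}"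
  have "\<Union> ?N \<subseteq> {1..n}"
    using Union_nodal_domains[OF pair_graph_path_graph, of n "extremal_vector n L K"]
    by (auto simp: path_graph_def)
  then have fin: "finite ?N" by (meson finite_UnionD finite_atLeastAtMost finite_subset)
  show ?thesis
  proof (cases "odd L")
    case True
    have "1 \<in> {1..end_width L}" "1 \<notin> {n - end_width L + 1..n}"
      using K by (auto simp: end_width_def)
    then have "{1..end_width L} \<noteq> {n - end_width L + 1..n}" by blast
    then have "card ?E = 2" by simp
    then show ?thesis
      using nodal_domains_extremal_vector[OF assms] True card_Diff_subset[of ?E ?N]
        card_mono[OF fin, of ?E] unfolding nodal_count_def by simp
  next
    case False
    then show ?thesis
      using nodal_domains_extremal_vector(1)[OF assms] card_mono[OF fin Diff_subset, of ?E]
      unfolding nodal_count_def by simp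
  qed
qed

text \<open>\<open>K\<close> is the largest number of inner blocks that fit between the end blocks,
  so the extremal vector meets the upper bound.\<close>

lemma max_nodal_count_path_graph:
  fixes n L :: nat
  defines "K \<equiv> (n - 2 * end_width L) div L"
  assumes n: "n \<ge> 2" and L: "L \<ge> 1" and h: "2 * end_width L \<le> n" and nz: "odd L \<or> K \<ge> 1"
  shows "max_nodal_count (1 / real L) (path_graph n) = K + (if odd L then 2 else 0)"
    and "nodal_count (path_graph n) (extremal_vector n L K) = max_nodal_count (1 / real L) (path_graph n)"
    and "laplacian1_eigenvector (path_graph n) (1 / real L) (extremal_vector n L K)"
proof -
  have K: "2 * end_width L + L * K \<le> n"
    using h times_div_less_eq_dividend[of L "n - 2 * end_width L"] unfolding K_def by linarith
  show ev: "laplacian1_eigenvector (path_graph n) (1 / real L) (extremal_vector n L K)"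
    by (rule extremal_vector_eigenvector[OF n L K nz])
  have le: "nodal_count (path_graph n) \<phi> \<le> K + (if odd L then 2 else 0)"
    if "laplacian1_eigenvector (path_graph n) (1 / real L) \<phi>" for \<phi>
    unfolding K_def by (rule nodal_count_path_graph_le[OF n L h that])
  then have eq: "nodal_count (path_graph n) (extremal_vector n L K) = K + (if odd L then 2 else 0)"
    using nodal_count_extremal_vector[OF n L K nz] ev le_antisym by blast
  show max: "max_nodal_count (1 / real L) (path_graph n) = K + (if odd L then 2 else 0)"
    unfolding max_nodal_count_def
    using finite_nodal_counts[OF pair_graph_path_graph] le ev eq[symmetric]
    by (intro Max_eqI) blast+
  show "nodal_count (path_graph n) (extremal_vector n L K) = max_nodal_count (1 / real L) (path_graph n)"
    unfolding max by (rule eq)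
qed


section \<open>Specialisation to \<open>L = 2 * r + 1\<close> and \<open>L = 2 * r\<close>\<close>

theorem theorem3:
  fixes n :: nat
  assumes "n \<ge> 2"
  shows "(\<forall>r::nat. int r \<le> \<lfloor>real n / 2\<rfloor> - 1 \<longrightarrow>
      int (max_nodal_count (1 / (2 * real r + 1)) (path_graph n))
        = \<lfloor>(real n + 2 * real r) / (2 * real r + 1)\<rfloor> \<and>
      (\<exists>\<phi>. laplacian1_eigenvector (path_graph n) (1 / (2 * real r + 1)) \<phi> \<and>
         nodal_count (path_graph n) \<phi>
           = max_nodal_count (1 / (2 * real r + 1)) (path_graph n) \<and>
         (\<exists>B. nodal_domains (path_graph n) \<phi> = {{1..r + 1}, {n - r..n}} \<union> B \<and>
            (\<forall>D\<in>B. \<exists>k. r + 1 < k \<and> k + 2 * r < n - r \<and> D = {k..k + 2 * r}))))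
    \<and> (\<forall>r::nat. 1 \<le> r \<and> int r \<le> \<lfloor>(real n - 2) / 4\<rfloor> \<longrightarrow>
      int (max_nodal_count (1 / (2 * real r)) (path_graph n))
        = \<lfloor>(real n - 2) / (2 * real r)\<rfloor> - 1 \<and>
      (\<exists>\<phi>. laplacian1_eigenvector (path_graph n) (1 / (2 * real r)) \<phi> \<and>
         nodal_count (path_graph n) \<phi>
           = max_nodal_count (1 / (2 * real r)) (path_graph n) \<and>
         (\<exists>a b. 1 \<le> a \<and> a < b \<and> b \<le> n \<and>
            (\<forall>i\<in>{1..a} \<union> {b..n}. \<phi> i = 0) \<and>
            (\<forall>D\<in>nodal_domains (path_graph n) \<phi>.
               \<exists>k. a < k \<and> k + 2 * r \<le> b \<and> D = {k..<k + 2 * r}))))"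
proof (intro conjI allI impI; (elim conjE)?)
  fix r :: nat
  assume r: "int r \<le> \<lfloor>real n / 2\<rfloor> - 1"
  define L where "L = 2 * r + 1"
  define K where "K = (n - 2 * end_width L) div L"
  define \<phi> where "\<phi> = extremal_vector n L K"
  have w: "end_width L = r + 1" by (simp add: end_width_def L_def)
  have "real r + 1 \<le> real n / 2" using r by linarith
  then have rn: "2 * r + 2 \<le> n" by linarith
  have L: "L \<ge> 1" "odd L" "2 * end_width L \<le> n" using rn w by (simp_all add: L_def)
  have \<mu>: "1 / (2 * real r + 1) = 1 / real L" by (simp add: L_def)
  note max = max_nodal_count_path_graph[OF assms L(1,3) disjI1[OF L(2)], folded K_def \<phi>_def \<mu>]
  \<comment> \<open>Adding \<open>2 * L\<close> before dividing accounts for the two end blocks in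
    the count.\<close>
  have "n + 2 * r = n - 2 * end_width L + 2 * L" using rn w by (simp add: L_def)
  then have "(n + 2 * r) div L = K + 2" unfolding K_def using L(1) by simp
  moreover have "\<lfloor>(real n + 2 * real r) / (2 * real r + 1)\<rfloor> = int ((n + 2 * r) div L)"
    using floor_divide_of_nat_eq[of "n + 2 * r" L, where 'a = real] by (simp add: L_def add.commute)
  ultimately show "int (max_nodal_count (1 / (2 * real r + 1)) (path_graph n))
      = \<lfloor>(real n + 2 * real r) / (2 * real r + 1)\<rfloor>"
    using max(1) L(2) by simp
  have "2 * end_width L + L * K \<le> n"
    using L(3) times_div_less_eq_dividend[of L "n - 2 * end_width L"] unfolding K_def by linarith
  moreover have nw: "n - end_width L + 1 = n - r" using rn w by simp
  ultimately have ends: "{{1..r + 1}, {n - r..n}} \<subseteq> nodal_domains (path_graph n) \<phi>"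
    using nodal_domains_extremal_vector(2)[OF assms L(1) _ disjI1[OF L(2)] L(2)]
    unfolding \<phi>_def w by metis
  have "\<exists>k. r + 1 < k \<and> k + 2 * r < n - r \<and> D = {k..k + 2 * r}"
    if D: "D \<in> nodal_domains (path_graph n) \<phi> - {{1..r + 1}, {n - r..n}}" for D
  proof -
    obtain k where "r + 1 < k" "k + L \<le> n - r" "D = {k..<k + L}"
      using nodal_domain_cases[OF assms L(1) max(3)[unfolded \<mu>], of D] D unfolding nw unfolding w by auto
    then show ?thesis by (intro exI[of _ k]) (auto simp: L_def)
  qed
  with ends max(2,3) show "\<exists>\<phi>. laplacian1_eigenvector (path_graph n) (1 / (2 * real r + 1)) \<phi> \<and>
         nodal_count (path_graph n) \<phi>
           = max_nodal_count (1 / (2 * real r + 1)) (path_graph n) \<and>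
         (\<exists>B. nodal_domains (path_graph n) \<phi> = {{1..r + 1}, {n - r..n}} \<union> B \<and>
            (\<forall>D\<in>B. \<exists>k. r + 1 < k \<and> k + 2 * r < n - r \<and> D = {k..k + 2 * r}))"
    by (intro exI[of _ \<phi>] conjI
        exI[of _ "nodal_domains (path_graph n) \<phi> - {{1..r + 1}, {n - r..n}}"]) blast+
next
  fix r :: nat
  assume r: "1 \<le> r" "int r \<le> \<lfloor>(real n - 2) / 4\<rfloor>"
  define L where "L = 2 * r"
  define K where "K = (n - 2 * end_width L) div L"
  define \<phi> where "\<phi> = extremal_vector n L K"
  have w: "end_width L = r + 1" by (simp add: end_width_def L_def)
  have "real r \<le> (real n - 2) / 4" using r(2) by linarith
  then have "real (4 * r + 2) \<le> real n" by simp
  then have rn: "4 * r + 2 \<le> n" by (simp only: of_nat_le_iff)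
  have L: "L \<ge> 1" "even L" "2 * end_width L \<le> n" using rn w r by (simp_all add: L_def)
  \<comment> \<open>The bound \<open>4 * r + 2 \<le> n\<close> leaves room for one inner block,
    without which the extremal vector would vanish.\<close>
  have "L \<le> n - 2 * end_width L" using rn w by (simp add: L_def)
  then have K1: "K \<ge> 1" unfolding K_def using L(1) by (simp add: Suc_le_eq div_greater_zero_iff)
  have \<mu>: "1 / (2 * real r) = 1 / real L" by (simp add: L_def)
  note max = max_nodal_count_path_graph[OF assms L(1,3) disjI2[OF K1[unfolded K_def]], folded K_def \<phi>_def \<mu>]
  have "n - 2 = n - 2 * end_width L + L" using rn w by (simp add: L_def)
  then have "(n - 2) div L = K + 1" unfolding K_def using L(1) by simp
  moreover have "\<lfloor>(real n - 2) / (2 * real r)\<rfloor> = int ((n - 2) div L)"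
    using floor_divide_of_nat_eq[of "n - 2" L, where 'a = real] assms by (simp add: L_def of_nat_diff)
  ultimately show "int (max_nodal_count (1 / (2 * real r)) (path_graph n))
      = \<lfloor>(real n - 2) / (2 * real r)\<rfloor> - 1"
    using max(1) L(2) by simp
  \<comment> \<open>The witnesses are \<open>a = r + 1\<close> and \<open>b = n - r\<close>: the end
    blocks of width \<open>r + 1\<close> carry flow but no entries.\<close>
  have zero: "\<forall>i\<in>{1..r + 1} \<union> {n - r..n}. \<phi> i = 0"
  proof -
    have "2 * end_width L + L * K \<le> n"
      using L(3) times_div_less_eq_dividend[of L "n - 2 * end_width L"] unfolding K_def by linarith
    then show ?thesis using L(2) w rn by (auto simp: \<phi>_def extremal_vector_def)
  qed
  have "\<exists>k. r + 1 < k \<and> k + 2 * r \<le> n - r \<and> D = {k..<k + 2 * r}"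
    if D: "D \<in> nodal_domains (path_graph n) \<phi>" for D
  proof -
    have "n - end_width L + 1 = n - r" using rn w by simp
    then show ?thesis
      using nodal_domain_cases[OF assms L(1) max(3)[unfolded \<mu>] D] L(2) w by (simp add: L_def)
  qed
  moreover have "1 \<le> r + 1" "r + 1 < n - r" "n - r \<le> n" using rn by linarith+
  ultimately show "\<exists>\<phi>. laplacian1_eigenvector (path_graph n) (1 / (2 * real r)) \<phi> \<and>
         nodal_count (path_graph n) \<phi>
           = max_nodal_count (1 / (2 * real r)) (path_graph n) \<and>
         (\<exists>a b. 1 \<le> a \<and> a < b \<and> b \<le> n \<and>
            (\<forall>i\<in>{1..a} \<union> {b..n}. \<phi> i = 0) \<and>
            (\<forall>D\<in>nodal_domains (path_graph n) \<phi>.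
               \<exists>k. a < k \<and> k + 2 * r \<le> b \<and> D = {k..<k + 2 * r}))"
    using max(2,3) zero by blast
qed

end
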